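(* Let $f:\mathbb{R}^n\to\mathbb{R}$ be twice continuously differentiable. Consider the problem $(\mathrm{C_2})$ of minimizing $f(x)$ over the unit simplex $\{x\in\mathbb{R}^n:\sum_i[x]_i\le1,\ [x]_i\ge0\ \forall i\}$, and the problem $(\mathrm{NC_2})$ of minimizing $f(z\odot z)$ over the unit ball $\{z\in\mathbb{R}^n:\|z\|_2\le1\}$. Then: 1. If $x^\star$ is a second-order KKT point of $(\mathrm{C_2})$, then every $z^\star\in\mathbb{R}^n$ with $z^\star\odot z^\star=x^\star$ is a second-order KKT point of $(\mathrm{NC_2})$. 2. Conversely, if $z^\star$ is a second-order KKT point of $(\mathrm{NC_2})$, then $x^\star=z^\star\odot z^\star$ is a second-order KKT point of $(\mathrm{C_2})$.
   Context: Notation: $[x]_i$ is the $i$th entry of $x$; $\odot$ is the entrywise product; $1_n$ is the all-ones vector; vector inequalities are entrywise. A point $x^\star$ is a second-order KKT point of $(\mathrm{C_2})$ if there exist $\lambda^\star\in\mathbb{R}$, $\beta^\star\in\mathbb{R}^n$ with $\nabla f(x^\star)=\lambda^\star1_n+\beta^\star$, $x^\star\ge0$, $\beta^\star\ge0$, $x^\star\odot\beta^\star=0$, $1_n^\top x^\star\le1$, $\lambda^\star\le0$, $(1_n^\top x^\star-1)\lambda^\star=0$; and $u^\top\nabla^2f(x^\star)u\ge0$ for all $u\in\mathbb{R}^n$ such that $[u]_k=0$ whenever $[x^\star]_k=0$ and, in case $1_n^\top x^\star=1$, also $1_n^\top u=0$. A point $z^\star$ is a second-order KKT point of $(\mathrm{NC_2})$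 if there exists $\lambda_N^\star\in\mathbb{R}$ with $\nabla f(z^\star\odot z^\star)\odot z^\star=\lambda_N^\star z^\star$, $\|z^\star\|_2^2\le1$, $\lambda_N^\star\le0$, $(\|z^\star\|_2^2-1)\lambda_N^\star=0$, and $$4(z^\star\odot d)^\top\nabla^2f(z^\star\odot z^\star)(z^\star\odot d)+2\langle\nabla f(z^\star\odot z^\star),d\odot d\rangle-2\lambda_N^\star\|d\|_2^2\ge0$$ for all $d\in\mathbb{R}^n$ if $\|z^\star\|_2<1$, and for all $d\perp z^\star$ if $\|z^\star\|_2=1$. *)

theory Defs
  imports "HOL-Analysis.Analysis"
begin

text \<open>
  On \<^typ>\<open>real ^ 'n\<close> the library operations are entrywise: \<^term>\<open>x * y\<close> is the Hadamard
  product, \<^term>\<open>1 :: real ^ 'n\<close> is the all-ones vector, and \<^term>\<open>x \<le> y\<close> is the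
  entrywise order.
\<close>

definition gradient :: "(real ^ 'n \<Rightarrow> real) \<Rightarrow> real ^ 'n \<Rightarrow> real ^ 'n" where
  "gradient f x = (THE D. GDERIV f x :> D)"

definition hessian :: "(real ^ 'n \<Rightarrow> real) \<Rightarrow> real ^ 'n \<Rightarrow> real ^ 'n ^ 'n" where
  "hessian f x = jacobian (gradient f) (at x)"

definition twice_continuously_differentiable :: "(real ^ 'n \<Rightarrow> real) \<Rightarrow> bool" where
  "twice_continuously_differentiable f \<longleftrightarrow>
     f differentiable_on UNIV \<and> gradient f differentiable_on UNIV \<and>
     continuous_on UNIV (hessian f)"

lemma gradient_eqI: "GDERIV f x :> D \<Longrightarrow> gradient f x = D"
  unfolding gradient_def gderiv_def
  by (rule the_equality) (auto dest: has_derivative_unique simp: fun_eq_iff vector_eq_ldot)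

lemma GDERIV_gradient:
  assumes "f differentiable at x"
  shows "GDERIV f x :> gradient f x"
proof -
  obtain f' where f': "(f has_derivative f') (at x)"
    using assms by (auto simp: differentiable_def)
  then have "linear f'" by (rule has_derivative_linear)
  then have "f' = (\<lambda>h. h \<bullet> adjoint f' 1)"
    by (simp add: adjoint_works)
  then have "GDERIV f x :> adjoint f' 1"
    using f' by (simp add: gderiv_def)
  then show ?thesis by (simp add: gradient_eqI)
qed

lemma has_derivative_gradient:
  assumes "gradient f differentiable at x"
  shows "(gradient f has_derivative (\<lambda>h. hessian f x *v h)) (at x)"
  using assms unfolding hessian_def by (simp add: jacobian_works)

text \<open>
  Problem \<open>C\<^sub>2\<close>: minimize \<open>f x\<close> subject to \<open>0 \<le> x\<close> and \<open>1 \<bullet> x \<le> 1\<close> (the unit simplex).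
  Stationarity is written as \<open>\<nabla>f(x) = lam *\<^sub>R 1 + \<beta>\<close>, so the multiplier \<open>lam\<close> of the
  inequality \<open>1 \<bullet> x \<le> 1\<close> is nonpositive and the multiplier \<open>\<beta>\<close> of \<open>0 \<le> x\<close> is nonnegative.
\<close>

definition second_order_KKT_C2 :: "(real ^ 'n \<Rightarrow> real) \<Rightarrow> real ^ 'n \<Rightarrow> bool" where
  "second_order_KKT_C2 f x \<longleftrightarrow>
     (\<exists>(lam::real) (\<beta>::real ^ 'n).
        gradient f x = lam *\<^sub>R 1 + \<beta> \<and> 0 \<le> x \<and> 0 \<le> \<beta> \<and> x * \<beta> = 0 \<and>
        1 \<bullet> x \<le> 1 \<and> lam \<le> 0 \<and> (1 \<bullet> x - 1) * lam = 0) \<and>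
     (\<forall>u. (\<forall>k. x $ k = 0 \<longrightarrow> u $ k = 0) \<and> (1 \<bullet> x = 1 \<longrightarrow> 1 \<bullet> u = 0) \<longrightarrow>
        0 \<le> u \<bullet> (hessian f x *v u))"

text \<open>
  Problem \<open>NC\<^sub>2\<close>: minimize \<open>f (z * z)\<close> subject to \<open>norm z \<le> 1\<close>.  The conditions are written
  in terms of the gradient and Hessian of \<open>f\<close> itself: the gradient of \<open>\<lambda>z. f (z * z)\<close> is
  \<open>2 \<nabla>f(z * z) * z\<close>, and the common factor 2 is dropped in the stationarity equation.
\<close>

definition second_order_KKT_NC2 :: "(real ^ 'n \<Rightarrow> real) \<Rightarrow> real ^ 'n \<Rightarrow> bool" where
  "second_order_KKT_NC2 f z \<longleftrightarrow>
     (\<exists>lam::real.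
        gradient f (z * z) * z = lam *\<^sub>R z \<and> (norm z)\<^sup>2 \<le> 1 \<and> lam \<le> 0 \<and>
        ((norm z)\<^sup>2 - 1) * lam = 0 \<and>
        (\<forall>d. norm z < 1 \<or> (norm z = 1 \<and> orthogonal d z) \<longrightarrow>
           0 \<le> 4 * ((z * d) \<bullet> (hessian f (z * z) *v (z * d)))
               + 2 * (gradient f (z * z) \<bullet> (d * d)) - 2 * lam * (norm d)\<^sup>2))"

end

theory Submission
  imports Defs
begin

text \<open>
  The substitution \<open>u = z * d\<close> matches the test directions of the two problems, and the multipliers
  are related by \<open>\<beta> = \<nabla>f(z * z) - lam *\<^sub>R 1\<close>.  In these terms the second-order form of the ball
  problem is \<open>4 (u \<bullet> \<nabla>\<^sup>2f u) + 2 (\<beta> \<bullet> (d * d))\<close>.  If \<open>\<beta> \<ge> 0\<close>, the curvature condition for \<open>u\<close>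
  makes it nonnegative.  Conversely, directions \<open>d = e\<^sub>k\<close> with \<open>z\<^sub>k = 0\<close> give \<open>u = 0\<close> and recover
  \<open>\<beta>\<^sub>k \<ge> 0\<close>, while \<open>d = u / z\<close>, extended by zero outside the support of \<open>z\<close>, kills the \<open>\<beta>\<close>-term.
\<close>

lemma one_inner_times_vec:
  fixes x y :: "real ^ 'n"
  shows "1 \<bullet> (x * y) = x \<bullet> y"
  by (simp add: inner_vec_def)

lemma one_inner_square_vec:
  fixes z :: "real ^ 'n"
  shows "1 \<bullet> (z * z) = (norm z)\<^sup>2"
  by (simp add: one_inner_times_vec power2_norm_eq_inner)

lemma shifted_inner_square_vec:
  fixes g d :: "real ^ 'n"
  shows "(g - lam *\<^sub>R 1) \<bullet> (d * d) = g \<bullet> (d * d) - lam * (norm d)\<^sup>2"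
  by (simp add: inner_diff_left one_inner_square_vec)

lemma second_order_KKT_C2_imp_NC2:
  fixes f :: "real ^ 'n \<Rightarrow> real"
  assumes "second_order_KKT_C2 f (z * z)"
  shows "second_order_KKT_NC2 f z"
proof -
  obtain lam \<beta> where g: "gradient f (z * z) = lam *\<^sub>R 1 + \<beta>"
    and \<beta>: "0 \<le> \<beta>" "z * z * \<beta> = 0"
    and lam: "1 \<bullet> (z * z) \<le> 1" "lam \<le> 0" "(1 \<bullet> (z * z) - 1) * lam = 0"
    and curv: "\<And>u. (\<forall>k. (z * z) $ k = 0 \<longrightarrow> u $ k = 0) \<Longrightarrow> (1 \<bullet> (z * z) = 1 \<longrightarrow> 1 \<bullet> u = 0)
                 \<Longrightarrow> 0 \<le> u \<bullet> (hessian f (z * z) *v u)"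
    using assms unfolding second_order_KKT_C2_def by blast
  \<comment> \<open>Complementarity says that in each coordinate \<open>z\<close> or
    \<open>\<beta>\<close> vanishes, so \<open>\<beta> * z = 0\<close>.\<close>
  have "gradient f (z * z) * z = lam *\<^sub>R z"
    using \<beta>(2) by (auto simp: g vec_eq_iff algebra_simps)
  moreover have "0 \<le> 4 * ((z * d) \<bullet> (hessian f (z * z) *v (z * d)))
      + 2 * (gradient f (z * z) \<bullet> (d * d)) - 2 * lam * (norm d)\<^sup>2"
    if d: "norm z < 1 \<or> (norm z = 1 \<and> orthogonal d z)" for d
  proof -
    have "0 \<le> (z * d) \<bullet> (hessian f (z * z) *v (z * d))"
    proof (rule curv)
      \<comment> \<open>If \<open>norm z < 1\<close> the premise fails; on the sphere,
        \<open>1 \<bullet> (z * d) = z \<bullet> d\<close> vanishes by orthogonality.\<close>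
      show "1 \<bullet> (z * z) = 1 \<longrightarrow> 1 \<bullet> (z * d) = 0"
        using d by (auto simp: one_inner_times_vec orthogonal_def inner_commute simp flip: norm_eq_1)
    qed simp
    moreover have "0 \<le> \<beta> \<bullet> (d * d)"
      using \<beta>(1) by (auto simp: inner_vec_def less_eq_vec_def intro!: sum_nonneg)
    ultimately show ?thesis
      using shifted_inner_square_vec[of "gradient f (z * z)" lam d] by (simp add: g)
  qed
  ultimately show ?thesis
    using lam unfolding second_order_KKT_NC2_def one_inner_square_vec by blast
qed

lemma second_order_KKT_NC2_imp_C2:
  fixes f :: "real ^ 'n \<Rightarrow> real"
  assumes "second_order_KKT_NC2 f z"
  shows "second_order_KKT_C2 f (z * z)"
proof -
  let ?g = "gradient f (z * z)" and ?H = "hessian f (z * z)"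
  obtain lam where stat: "?g * z = lam *\<^sub>R z"
    and lam: "(norm z)\<^sup>2 \<le> 1" "lam \<le> 0" "((norm z)\<^sup>2 - 1) * lam = 0"
    and curv: "\<And>d. norm z < 1 \<or> (norm z = 1 \<and> orthogonal d z) \<Longrightarrow>
      0 \<le> 4 * ((z * d) \<bullet> (?H *v (z * d))) + 2 * (?g \<bullet> (d * d)) - 2 * lam * (norm d)\<^sup>2"
    using assms unfolding second_order_KKT_NC2_def by blast
  define \<beta> where "\<beta> = ?g - lam *\<^sub>R 1"
  \<comment> \<open>Since \<open>1 \<bullet> (d * d) = (norm d)\<^sup>2\<close>, the
    \<open>lam\<close> term is absorbed into \<open>\<beta>\<close>. Feasibility of \<open>z\<close>
    turns \<open>norm z < 1\<close> into \<open>norm z \<noteq> 1\<close>.\<close>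
  have curv': "0 \<le> 4 * ((z * d) \<bullet> (?H *v (z * d))) + 2 * (\<beta> \<bullet> (d * d))"
    if "z \<bullet> d = 0 \<or> norm z \<noteq> 1" for d
  proof -
    have "norm z \<le> 1"
      using lam(1) by (simp add: power_le_one_iff)
    then have "norm z < 1 \<or> (norm z = 1 \<and> orthogonal d z)"
      using that by (auto simp: orthogonal_def inner_commute)
    from curv[OF this] show ?thesis
      by (simp add: \<beta>_def shifted_inner_square_vec right_diff_distrib)
  qed
  have \<beta>_supp: "\<beta> $ k = 0" if "z $ k \<noteq> 0" for k
    using stat that by (auto simp: \<beta>_def vec_eq_iff)
  have "0 \<le> \<beta> $ k" for k
  proof (cases "z $ k = 0")
    case True
    \<comment> \<open>The direction \<open>axis k 1\<close> is thus admissible even when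
      \<open>norm z = 1\<close>.\<close>
    have "z \<bullet> axis k 1 = 0"
      using True by (simp add: inner_axis)
    moreover have "z * axis k 1 = 0" "axis k 1 * axis k 1 = (axis k 1 :: real ^ 'n)"
      using True by (auto simp: vec_eq_iff axis_def)
    ultimately show ?thesis
      using curv'[of "axis k 1"] by (simp add: inner_axis)
  qed (simp add: \<beta>_supp)
  then have "0 \<le> \<beta>"
    by (simp add: less_eq_vec_def)
  moreover have "z * z * \<beta> = 0"
    using \<beta>_supp by (auto simp: vec_eq_iff)
  moreover have "0 \<le> z * z"
    by (simp add: less_eq_vec_def)
  moreover have "?g = lam *\<^sub>R 1 + \<beta>"
    by (simp add: \<beta>_def)
  moreover have "0 \<le> u \<bullet> (?H *v u)"
    if supp: "\<forall>k. (z * z) $ k = 0 \<longrightarrow> u $ k = 0" and tang: "1 \<bullet> (z * z) = 1 \<longrightarrow> 1 \<bullet> u = 0" for u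
  proof -
    \<comment> \<open>Division by zero yields 0, so \<open>d\<close> vanishes wherever
      \<open>z\<close> does, while \<open>\<beta>\<close> vanishes wherever \<open>z\<close> does
      not.\<close>
    define d where "d = (\<chi> k. u $ k / z $ k)"
    have zd: "z * d = u"
      using supp by (auto simp: d_def vec_eq_iff)
    have "\<beta> $ k * (d * d) $ k = 0" for k
      by (cases "z $ k = 0") (simp_all add: d_def \<beta>_supp)
    then have "\<beta> \<bullet> (d * d) = 0"
      by (simp only: inner_vec_def inner_real_def sum.neutral_const)
    \<comment> \<open>Here \<open>z \<bullet> d = 1 \<bullet> u\<close>, so tangency to the simplex
      face becomes tangency to the sphere.\<close>
    moreover have "z \<bullet> d = 0 \<or> norm z \<noteq> 1"
      using tang one_inner_times_vec[of z d] by (auto simp: one_inner_square_vec zd)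
    ultimately show ?thesis
      using curv'[of d] by (simp add: zd)
  qed
  ultimately show ?thesis
    using lam unfolding second_order_KKT_C2_def
    by (intro conjI exI[of _ lam] exI[of _ \<beta>] allI impI) (simp_all add: one_inner_square_vec)
qed

theorem theorem7:
  fixes f :: "real ^ 'n \<Rightarrow> real"
  assumes "twice_continuously_differentiable f"
  shows "(\<forall>x. second_order_KKT_C2 f x \<longrightarrow>
            (\<forall>z. z * z = x \<longrightarrow> second_order_KKT_NC2 f z)) \<and>
         (\<forall>z. second_order_KKT_NC2 f z \<longrightarrow> second_order_KKT_C2 f (z * z))"
  using second_order_KKT_C2_imp_NC2 second_order_KKT_NC2_imp_C2 by blast

end
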